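(* Let $\preceq$ be a total order on $\mathbb{T}$ compatible with arithmetic operations. Let $\alpha\in\mathbb{T}$ and $\alpha',\alpha''\in N_{ull}(\alpha)$. Then: (i) if $I_0\subseteq P_{\preceq}$, then $\alpha'\preceq\alpha''$ if and only if $\sup S_{upp}(\alpha')\le\sup S_{upp}(\alpha'')$; (ii) if $I_0\cap P_{\preceq}=\emptyset$, then $\alpha'\preceq\alpha''$ if and only if $\sup S_{upp}(\alpha')\ge\sup S_{upp}(\alpha'')$, that is, if and only if $\inf S_{upp}(\alpha')\le\inf S_{upp}(\alpha'')$. Consequently, each nullifying set $N_{ull}(\alpha)$, with the restriction of $\preceq$, has a minimum if $I_0\subseteq P_{\preceq}$ and a maximum if $I_0\cap P_{\preceq}=\emptyset$.
   Context: Triangular fuzzy numbers: $\mathbb{T}=\{(a_1,a,a_2)\in\mathbb{R}^3: a_1\le a\le a_2\}$. Each $t\in\mathbb{R}$ is identified with the scalar $(t,t,t)\in\mathbb{T}$; in particular $0=(0,0,0)$. For $\alpha=(a_1,a,a_2)$, $\inf S_{upp}(\alpha)=a_1$ and $\sup S_{upp}(\alpha)=a_2$ (infimum and supremum of the support). Operations: $(a_1,a,a_2)+(b_1,b,b_2)=(a_1+b_1,a+b,a_2+b_2)$; for $t\in\mathbb{R}$, $t(a_1,a,a_2)=(ta_1,ta,ta_2)$ if $t\ge0$ and $(ta_2,ta,ta_1)$ if $t<0$; $-\alpha=(-1)\alpha$, $\alpha-\beta=\alpha+(-1)\beta$. A total order is total, reflexive, antisymmetric and transitive; $\alpha\prec\beta$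 means $\alpha\preceq\beta$ and $\alpha\neq\beta$. $P_{\preceq}=\{\alpha\in\mathbb{T}:0\prec\alpha\}$ and $I_0=\{(-t,0,t): t\in\mathbb{R},\ t>0\}$. Compatibility with arithmetic operations: $\alpha\preceq\beta$ implies $\alpha+\gamma\preceq\beta+\gamma$ for all $\gamma\in\mathbb{T}$, and $t\alpha\preceq t\beta$ for all real $t\ge0$. Nullifying set of $\alpha=(a_1,a,a_2)$: $N_{ull}(\alpha)=\{\beta\in\mathbb{T}:\alpha-\beta\in I_0\cup\{0\}\}=\{(x,a,y)\in\mathbb{T}:x+y=a_1+a_2\}$. *)

theory Defs
  imports Complex_Main
begin

typedef tfn = "{(a1 :: real, a :: real, a2 :: real). a1 \<le> a \<and> a \<le> a2}"
  morphisms triple_of Tfn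
  by (rule exI[of _ "(0, 0, 0)"]) simp

setup_lifting type_definition_tfn

text \<open>The closure of the support of the fuzzy number \<open>(a1, a, a2)\<close> is the interval
  \<open>{a1..a2}\<close>, so the outer components are its infimum and supremum.\<close>

lift_definition inf_supp :: "tfn \<Rightarrow> real" is "\<lambda>(a1, a, a2). a1" .

lift_definition sup_supp :: "tfn \<Rightarrow> real" is "\<lambda>(a1, a, a2). a2" .

lift_definition scalar :: "real \<Rightarrow> tfn" is "\<lambda>t. (t, t, t)"
  by simp

text \<open>Triangular fuzzy numbers are not a real vector space (in general
  \<open>\<alpha> - \<alpha> \<noteq> 0\<close>), so \<open>scaleR\<close> is not instantiated.\<close>

lift_definition smult :: "real \<Rightarrow> tfn \<Rightarrow> tfn" (infixr "\<odot>" 75)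
  is "\<lambda>t (a1, a, a2). if t \<ge> 0 then (t * a1, t * a, t * a2) else (t * a2, t * a, t * a1)"
  by (auto simp: mult_left_mono mult_left_mono_neg split: if_splits)

instantiation tfn :: "{zero, plus, uminus, minus}"
begin

definition zero_tfn :: tfn where "0 = scalar 0"

lift_definition plus_tfn :: "tfn \<Rightarrow> tfn \<Rightarrow> tfn"
  is "\<lambda>(a1, a, a2) (b1, b, b2). (a1 + b1, a + b, a2 + b2)"
  by auto

definition uminus_tfn :: "tfn \<Rightarrow> tfn" where "- \<alpha> = (-1) \<odot> \<alpha>" for \<alpha> :: tfn

definition minus_tfn :: "tfn \<Rightarrow> tfn \<Rightarrow> tfn" where "\<alpha> - \<beta> = \<alpha> + (-1) \<odot> \<beta>" for \<alpha> \<beta> :: tfn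

instance ..

end

definition total_order :: "('a \<Rightarrow> 'a \<Rightarrow> bool) \<Rightarrow> bool" where
  "total_order le \<longleftrightarrow> totalp le \<and> reflp le \<and> antisymp le \<and> transp le"

definition strict :: "('a \<Rightarrow> 'a \<Rightarrow> bool) \<Rightarrow> 'a \<Rightarrow> 'a \<Rightarrow> bool" where
  "strict le \<alpha> \<beta> \<longleftrightarrow> le \<alpha> \<beta> \<and> \<alpha> \<noteq> \<beta>"

definition arith_compatible :: "(tfn \<Rightarrow> tfn \<Rightarrow> bool) \<Rightarrow> bool" where
  "arith_compatible le \<longleftrightarrow>
    (\<forall>\<alpha> \<beta>. le \<alpha> \<beta> \<longrightarrow> (\<forall>\<gamma>. le (\<alpha> + \<gamma>) (\<beta> + \<gamma>)) \<and> (\<forall>t\<ge>0. le (t \<odot> \<alpha>) (t \<odot> \<beta>)))"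

definition positives :: "(tfn \<Rightarrow> tfn \<Rightarrow> bool) \<Rightarrow> tfn set" where
  "positives le = {\<alpha>. strict le 0 \<alpha>}"

definition I\<^sub>0 :: "tfn set" where
  "I\<^sub>0 = {\<alpha>. \<exists>t>0. triple_of \<alpha> = (- t, 0, t)}"

definition Null :: "tfn \<Rightarrow> tfn set" where
  "Null \<alpha> = {\<beta>. \<alpha> - \<beta> \<in> I\<^sub>0 \<union> {0}}"

lemma Null_eq:
  assumes "triple_of \<alpha> = (a1, a, a2)"
  shows "Null \<alpha> = {\<beta>. \<exists>x y. triple_of \<beta> = (x, a, y) \<and> x + y = a1 + a2}"
proof -
  have "\<beta> \<in> Null \<alpha> \<longleftrightarrow> (\<exists>x y. triple_of \<beta> = (x, a, y) \<and> x + y = a1 + a2)" for \<beta>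
  proof -
    obtain b1 b b2 where \<beta>: "triple_of \<beta> = (b1, b, b2)"
      by (cases "triple_of \<beta>")
    have le: "a1 \<le> a" "a \<le> a2" "b1 \<le> b" "b \<le> b2"
      using triple_of[of \<alpha>] triple_of[of \<beta>] assms \<beta> by auto
    have "triple_of (\<alpha> - \<beta>) = (a1 - b2, a - b, a2 - b1)"
      by (simp add: minus_tfn_def plus_tfn.rep_eq smult.rep_eq assms \<beta>)
    moreover have "\<alpha> - \<beta> = 0 \<longleftrightarrow> triple_of (\<alpha> - \<beta>) = (0, 0, 0)"
      by (metis scalar.rep_eq triple_of_inject zero_tfn_def)
    ultimately show ?thesis
      using le unfolding Null_def I\<^sub>0_def by (auto simp: \<beta>)
  qed
  then show ?thesis by blast
qed

definition is_minimum :: "('a \<Rightarrow> 'a \<Rightarrow> bool) \<Rightarrow> 'a set \<Rightarrow> 'a \<Rightarrow> bool" where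
  "is_minimum le A m \<longleftrightarrow> m \<in> A \<and> (\<forall>\<beta>\<in>A. le m \<beta>)"

definition is_maximum :: "('a \<Rightarrow> 'a \<Rightarrow> bool) \<Rightarrow> 'a set \<Rightarrow> 'a \<Rightarrow> bool" where
  "is_maximum le A m \<longleftrightarrow> m \<in> A \<and> (\<forall>\<beta>\<in>A. le \<beta> m)"

end

theory Submission
  imports Defs
begin

text \<open>Two elements of the same nullifying set have the same peak and the same sum of endpoints,
  so the one with the larger supremum arises from the other by adding an element of
  \<open>I\<^sub>0\<close>. Since the order is translation invariant, the sign of the elements of
  \<open>I\<^sub>0\<close> decides the comparison. The extremum of a nullifying set is its element of
  least spread, one side of which is degenerate.\<close>

lemma tfn_eq_iff: "\<alpha> = \<beta> \<longleftrightarrow> triple_of \<alpha> = triple_of \<beta>" for \<alpha> \<beta> :: tfn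
  by (simp add: triple_of_inject)

lemma tfn_add_0_left: "0 + \<alpha> = \<alpha>" for \<alpha> :: tfn
  by (cases "triple_of \<alpha>")
    (simp add: tfn_eq_iff plus_tfn.rep_eq zero_tfn_def scalar.rep_eq)

text \<open>Within a nullifying set this trades an inequality between suprema for the reverse
  inequality between infima, which gives the second form of the criterion in the nonpositive
  case.\<close>

lemma Null_inf_plus_sup:
  assumes "\<beta> \<in> Null \<alpha>"
  shows "inf_supp \<beta> + sup_supp \<beta> = inf_supp \<alpha> + sup_supp \<alpha>"
proof -
  obtain a1 a a2 where "triple_of \<alpha> = (a1, a, a2)"
    by (cases "triple_of \<alpha>")
  with assms show ?thesis
    by (auto simp: Null_eq inf_supp.rep_eq sup_supp.rep_eq)
qed

text \<open>The peak and the sum of the endpoints are fixed by \<open>\<alpha>\<close>, so the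
  supremum is the only free parameter.\<close>

lemma inj_on_sup_supp_Null: "inj_on sup_supp (Null \<alpha>)"
proof -
  obtain a1 a a2 where "triple_of \<alpha> = (a1, a, a2)"
    by (cases "triple_of \<alpha>")
  then show ?thesis
    by (auto simp: inj_on_def Null_eq tfn_eq_iff sup_supp.rep_eq)
qed

lemma Null_add_I0:
  assumes "\<beta> \<in> Null \<alpha>" "\<gamma> \<in> Null \<alpha>" "sup_supp \<beta> < sup_supp \<gamma>"
  obtains \<iota> where "\<iota> \<in> I\<^sub>0" "\<gamma> = \<iota> + \<beta>"
proof -
  obtain a1 a a2 where \<alpha>: "triple_of \<alpha> = (a1, a, a2)"
    by (cases "triple_of \<alpha>")
  obtain x y where \<beta>: "triple_of \<beta> = (x, a, y)" "x + y = a1 + a2"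
    using assms(1) by (auto simp: Null_eq[OF \<alpha>])
  obtain x' y' where \<gamma>: "triple_of \<gamma> = (x', a, y')" "x' + y' = a1 + a2"
    using assms(2) by (auto simp: Null_eq[OF \<alpha>])
  have "y < y'"
    using assms(3) \<beta> \<gamma> by (simp add: sup_supp.rep_eq)
  \<comment> \<open>Equal endpoint sums give \<open>x' - x = y - y'\<close>, so the componentwise
    difference of \<open>\<gamma>\<close> and \<open>\<beta>\<close> is symmetric about 0. This is
    not the fuzzy difference \<open>\<gamma> - \<beta>\<close>, which swaps the endpoints of
    \<open>\<beta>\<close>.\<close>
  then have \<iota>: "triple_of (Tfn (y - y', 0, y' - y)) = (y - y', 0, y' - y)"
    by (intro Tfn_inverse) auto
  show thesis
  proof
    show "Tfn (y - y', 0, y' - y) \<in> I\<^sub>0"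
      using \<open>y < y'\<close> by (auto simp: I\<^sub>0_def \<iota> intro!: exI[of _ "y' - y"])
    show "\<gamma> = Tfn (y - y', 0, y' - y) + \<beta>"
      using \<beta> \<gamma> by (simp add: tfn_eq_iff plus_tfn.rep_eq \<iota>)
  qed
qed

lemma Null_least_sup_supp:
  obtains m where "m \<in> Null \<alpha>" "\<And>\<beta>. \<beta> \<in> Null \<alpha> \<Longrightarrow> sup_supp m \<le> sup_supp \<beta>"
proof -
  obtain a1 a a2 where \<alpha>: "triple_of \<alpha> = (a1, a, a2)"
    by (cases "triple_of \<alpha>")
  \<comment> \<open>A triple \<open>(a1 + a2 - y, a, y)\<close> is a fuzzy number exactly when
    \<open>a \<le> y\<close> and \<open>a1 + a2 - a \<le> y\<close>; the maximum is the least such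
    \<open>y\<close>.\<close>
  define y where "y = max a (a1 + a2 - a)"
  have m: "triple_of (Tfn (a1 + a2 - y, a, y)) = (a1 + a2 - y, a, y)"
    by (intro Tfn_inverse) (auto simp: y_def)
  show thesis
  proof
    show "Tfn (a1 + a2 - y, a, y) \<in> Null \<alpha>"
      by (simp add: Null_eq[OF \<alpha>] m)
    fix \<beta> assume "\<beta> \<in> Null \<alpha>"
    then obtain u v where \<beta>: "triple_of \<beta> = (u, a, v)" "u + v = a1 + a2"
      by (auto simp: Null_eq[OF \<alpha>])
    moreover have "u \<le> a" "a \<le> v"
      using triple_of[of \<beta>] \<beta> by auto
    ultimately have "y \<le> v"
      by (simp add: y_def)
    then show "sup_supp (Tfn (a1 + a2 - y, a, y)) \<le> sup_supp \<beta>"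
      by (simp add: sup_supp.rep_eq m \<beta>)
  qed
qed

text \<open>One implication for strict inequalities suffices: if \<open>f y < f x\<close> while
  \<open>le x y\<close>, antisymmetry forces \<open>x = y\<close>, a contradiction, and ties of
  \<open>f\<close> are settled by injectivity and reflexivity.\<close>

lemma order_iff_of_strict_mono:
  fixes f :: "'a \<Rightarrow> 'b::linorder"
  assumes "reflp le" "antisymp le" "inj_on f A"
    and "\<And>x y. x \<in> A \<Longrightarrow> y \<in> A \<Longrightarrow> f x < f y \<Longrightarrow> le x y"
    and "x \<in> A" "y \<in> A"
  shows "le x y \<longleftrightarrow> f x \<le> f y"
proof
  assume "le x y"
  show "f x \<le> f y"
  proof (rule ccontr)
    assume "\<not> f x \<le> f y"
    then have "f y < f x" by simp
    then have "le y x" using assms(4-6) by blast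
    then have "x = y" using \<open>le x y\<close> assms(2) by (blast dest: antisympD)
    with \<open>f y < f x\<close> show False by simp
  qed
next
  assume "f x \<le> f y"
  then consider "f x < f y" | "f x = f y" by fastforce
  then show "le x y"
  proof cases
    case 1
    then show ?thesis using assms(4-6) by blast
  next
    case 2
    then have "x = y" using assms(3,5,6) by (blast dest: inj_onD)
    then show ?thesis using assms(1) by (auto intro: reflpD)
  qed
qed

lemma add_right_le:
  assumes "arith_compatible le" "le \<alpha> \<beta>"
  shows "le (\<alpha> + \<gamma>) (\<beta> + \<gamma>)"
  using assms unfolding arith_compatible_def by blast

lemma add_positive_le:
  assumes "arith_compatible le" "\<iota> \<in> positives le"
  shows "le \<beta> (\<iota> + \<beta>)"
  using add_right_le[OF assms(1), of 0 \<iota> \<beta>] assms(2)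
  by (simp add: positives_def strict_def tfn_add_0_left)

text \<open>Totality turns the failure of \<open>\<iota>\<close> to be positive into
  \<open>le \<iota> 0\<close>, which is then translated by \<open>\<beta>\<close>.\<close>

lemma add_nonpositive_le:
  assumes "total_order le" "arith_compatible le" "\<iota> \<notin> positives le"
  shows "le (\<iota> + \<beta>) \<beta>"
proof -
  have "le \<iota> 0"
  proof (cases "\<iota> = 0")
    case True
    then show ?thesis
      using assms(1) by (auto simp: total_order_def intro: reflpD)
  next
    case False
    then show ?thesis
      using assms(1,3) totalpD[of le \<iota> 0] by (auto simp: total_order_def positives_def strict_def)
  qed
  then show ?thesis
    using add_right_le[OF assms(2), of \<iota> 0 \<beta>] by (simp add: tfn_add_0_left)
qed

lemma le_iff_sup_le_of_I0_positive:
  assumes "total_order le" "arith_compatible le" "I\<^sub>0 \<subseteq> positives le"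
    and "\<beta> \<in> Null \<alpha>" "\<gamma> \<in> Null \<alpha>"
  shows "le \<beta> \<gamma> \<longleftrightarrow> sup_supp \<beta> \<le> sup_supp \<gamma>"
proof (rule order_iff_of_strict_mono[where A = "Null \<alpha>"])
  fix x y assume "x \<in> Null \<alpha>" "y \<in> Null \<alpha>" "sup_supp x < sup_supp y"
  then obtain \<iota> where "\<iota> \<in> I\<^sub>0" "y = \<iota> + x"
    by (rule Null_add_I0)
  then show "le x y"
    using assms(2,3) by (auto intro: add_positive_le)
qed (use assms inj_on_sup_supp_Null in \<open>simp_all add: total_order_def\<close>)

lemma le_iff_sup_ge_of_I0_nonpositive:
  assumes "total_order le" "arith_compatible le" "I\<^sub>0 \<inter> positives le = {}"
    and "\<beta> \<in> Null \<alpha>" "\<gamma> \<in> Null \<alpha>"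
  shows "le \<beta> \<gamma> \<longleftrightarrow> sup_supp \<gamma> \<le> sup_supp \<beta>"
proof -
  \<comment> \<open>Negating the suprema turns the order-reversing case into an instance of the same
    monotonicity criterion.\<close>
  have "le \<beta> \<gamma> \<longleftrightarrow> - sup_supp \<beta> \<le> - sup_supp \<gamma>"
  proof (rule order_iff_of_strict_mono[where A = "Null \<alpha>"])
    fix x y assume "x \<in> Null \<alpha>" "y \<in> Null \<alpha>" "- sup_supp x < - sup_supp y"
    \<comment> \<open>Now \<open>x\<close> has the larger supremum, so it is \<open>x\<close> that
      arises from \<open>y\<close> by adding an element of \<open>I\<^sub>0\<close>.\<close>
    then obtain \<iota> where "\<iota> \<in> I\<^sub>0" "x = \<iota> + y"
      using Null_add_I0[of y \<alpha> x] by auto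
    then show "le x y"
      using assms(1-3) by (auto intro: add_nonpositive_le)
  next
    show "inj_on (\<lambda>\<beta>. - sup_supp \<beta>) (Null \<alpha>)"
      using inj_on_sup_supp_Null[of \<alpha>] by (simp add: inj_on_def)
  qed (use assms in \<open>simp_all add: total_order_def\<close>)
  then show ?thesis by simp
qed

theorem theorem20:
  fixes le :: "tfn \<Rightarrow> tfn \<Rightarrow> bool"  (infix "\<preceq>" 50)
  assumes "total_order (\<preceq>)"
    and "arith_compatible (\<preceq>)"
  shows "(\<forall>\<alpha>. \<forall>\<alpha>' \<in> Null \<alpha>. \<forall>\<alpha>'' \<in> Null \<alpha>.
      (I\<^sub>0 \<subseteq> positives (\<preceq>) \<longrightarrow>
        (\<alpha>' \<preceq> \<alpha>'' \<longleftrightarrow> sup_supp \<alpha>' \<le> sup_supp \<alpha>'')) \<and>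
      (I\<^sub>0 \<inter> positives (\<preceq>) = {} \<longrightarrow>
        (\<alpha>' \<preceq> \<alpha>'' \<longleftrightarrow> sup_supp \<alpha>' \<ge> sup_supp \<alpha>'') \<and>
        (\<alpha>' \<preceq> \<alpha>'' \<longleftrightarrow> inf_supp \<alpha>' \<le> inf_supp \<alpha>''))) \<and>
    (I\<^sub>0 \<subseteq> positives (\<preceq>) \<longrightarrow> (\<forall>\<alpha>. \<exists>m. is_minimum (\<preceq>) (Null \<alpha>) m)) \<and>
    (I\<^sub>0 \<inter> positives (\<preceq>) = {} \<longrightarrow> (\<forall>\<alpha>. \<exists>m. is_maximum (\<preceq>) (Null \<alpha>) m))"
proof (intro conjI allI ballI impI)
  fix \<alpha> \<beta> \<gamma>
  assume \<beta>\<gamma>: "\<beta> \<in> Null \<alpha>" "\<gamma> \<in> Null \<alpha>"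
  show "\<beta> \<preceq> \<gamma> \<longleftrightarrow> sup_supp \<beta> \<le> sup_supp \<gamma>" if "I\<^sub>0 \<subseteq> positives (\<preceq>)"
    using assms that \<beta>\<gamma> by (rule le_iff_sup_le_of_I0_positive)
  show ge: "\<beta> \<preceq> \<gamma> \<longleftrightarrow> sup_supp \<beta> \<ge> sup_supp \<gamma>" if "I\<^sub>0 \<inter> positives (\<preceq>) = {}"
    using assms that \<beta>\<gamma> by (rule le_iff_sup_ge_of_I0_nonpositive)
  show "\<beta> \<preceq> \<gamma> \<longleftrightarrow> inf_supp \<beta> \<le> inf_supp \<gamma>" if "I\<^sub>0 \<inter> positives (\<preceq>) = {}"
    using ge[OF that] \<beta>\<gamma>[THEN Null_inf_plus_sup] by linarith
next
  fix \<alpha>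
  \<comment> \<open>One element serves both claims: least supremum means minimum when
    \<open>\<preceq>\<close> follows the suprema, and maximum when it reverses them.\<close>
  obtain m where m: "m \<in> Null \<alpha>" "\<And>\<beta>. \<beta> \<in> Null \<alpha> \<Longrightarrow> sup_supp m \<le> sup_supp \<beta>"
    using Null_least_sup_supp by blast
  show "\<exists>m. is_minimum (\<preceq>) (Null \<alpha>) m" if "I\<^sub>0 \<subseteq> positives (\<preceq>)"
    using m le_iff_sup_le_of_I0_positive[OF assms that] unfolding is_minimum_def by blast
  show "\<exists>m. is_maximum (\<preceq>) (Null \<alpha>) m" if "I\<^sub>0 \<inter> positives (\<preceq>) = {}"
    using m le_iff_sup_ge_of_I0_nonpositive[OF assms that] unfolding is_maximum_def by blast
qed

end
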